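(* Consider a nand Markov random field with objective $\rho(\mathbf{X})$ and graph $\mathcal{G}=(\mathcal{V},\mathcal{E})$, built from a graphical model with clique potentials $\psi_c(X_c)>1$. If $\mathcal{G}$ is a perfect graph, then the convergent message passing algorithm run on it finds the MAP estimate: at convergence (a fixed point of the message updates), its output $\hat{\mathbf{X}}=\{\hat{\mathbf{x}}_i\}_{i\in\mathcal{V}}$ is a maximizer of $\rho$ over all binary assignments.
   Context: Graphical model: $G=(V,E)$ is a finite undirected graph with vertices $v_1,\dots,v_n$; vertex $v_i$ carries a discrete variable $x_i\in\{0,\dots,|x_i|-1\}$, where $|x_i|\ge2$ denotes its number of settings. $C$ is the set of maximal cliques of $G$, and $X_c=\{x_i: i\in c\}$. The model is $p(X)=\frac1Z\prod_{c\in C}\psi_c(X_c)$ with $Z$ the normalizing constant; the potentials are assumed scaled so that $\psi_c(X_c)>1$ for all $c$ and $X_c$. Nand Markov random field (NMRF): for each $c\in C$ enumerate the $|\mathbf{X}_c|:=\prod_{i\in c}|x_i|$ joint configurations of $X_c$ as $k=1,\dots,|\mathbf{X}_c|$, and introduce one binary variable $\mathbf{x}_{c,k}\in\{0,1\}$ for each. Let $f_{c,k}=\log\psi_c(X_c)>0$ evaluated at the $k$-th configuration of $X_c$. Let $\mathcal{G}=(\mathcal{V},\mathcal{E})$ have one vertex for each variable $\mathbf{x}_{c,k}$, the vertices of $\mathbf{x}_{c,k}$ and $\mathbf{x}_{d,l}$ being adjacent iff the $k$-th configuration of $X_c$ and the $l$-th configuration of $X_d$ assign different values to some variable $x_i$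 with $i\in c\cap d$ (in particular, distinct vertices of the same clique are adjacent). Index the vertices of $\mathcal{G}$ by $i\in\mathcal{V}$ with variables $\mathbf{x}_i$ and weights $f_i>0$. The objective is $\rho(\mathbf{X})=\prod_{i\in\mathcal{V}}e^{f_i\mathbf{x}_i}\prod_{ij\in\mathcal{E}}\delta(\mathbf{x}_i+\mathbf{x}_j\le1)$, where $\delta$ is $1$ if its argument is true and $0$ otherwise. A graph is perfect if every induced subgraph has chromatic number equal to its clique number. A MAP estimate is any maximizer of $\rho$ (ties are allowed; any maximizer is acceptable). Convergent message passing: write $\mathrm{Ne}(i)$ for the set of neighbors of $i$ in $\mathcal{G}$ and, for $ij\in\mathcal{E}$, $$\theta_{ij}(\mathbf{x}_i,\mathbf{x}_j)=\frac{\mathbf{x}_if_i}{|\mathrm{Ne}(i)|}+\frac{\mathbf{x}_jf_j}{|\mathrm{Ne}(j)|}+\log\delta(\mathbf{x}_i+\mathbf{x}_j\le1),$$ so that $\log\rho(\mathbf{X})=\sum_{ij\in\mathcal{E}}\theta_{ij}(\mathbf{x}_i,\mathbf{x}_j)$ (with $\log 0=-\infty$, in practice replaced by a large negative constant). The algorithm is: (1) initialize all messages $\lambda_{ji}(\mathbf{x}_i)$ to any value; (2) for each $ij\in\mathcal{E}$, simultaneously update $$\lambda_{ji}(\mathbf{x}_i)\leftarrow-\tfrac12\sum_{k\in\mathrm{Ne}(i)\setminus j}\lambda_{ki}(\mathbf{x}_i)+\tfrac12\max_{\mathbf{x}_j}\Big[\sum_{k\in\mathrm{Ne}(j)\setminus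 i}\lambda_{kj}(\mathbf{x}_j)+\theta_{ij}(\mathbf{x}_i,\mathbf{x}_j)\Big],$$ $$\lambda_{ij}(\mathbf{x}_j)\leftarrow-\tfrac12\sum_{k\in\mathrm{Ne}(j)\setminus i}\lambda_{kj}(\mathbf{x}_j)+\tfrac12\max_{\mathbf{x}_i}\Big[\sum_{k\in\mathrm{Ne}(i)\setminus j}\lambda_{ki}(\mathbf{x}_i)+\theta_{ij}(\mathbf{x}_i,\mathbf{x}_j)\Big];$$ (3) repeat step 2 until convergence; (4) set $b(\mathbf{x}_i)=\sum_{j\in\mathrm{Ne}(i)}\lambda_{ji}(\mathbf{x}_i)$ for all $i\in\mathcal{V}$; (5) output $\hat{\mathbf{x}}_i=\arg\max_{\mathbf{x}_i}b(\mathbf{x}_i)$ for all $i\in\mathcal{V}$.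
   Formalization: The output is shown to be a maximizer of ρ when no belief b(x_i) has a tied argmax; with ties, only that some choice of argmaxes is a maximizer. As stated the claim fails: for two adjacent vertices with equal weights all beliefs tie, and (0,0), (1,1) are admissible outputs but not maximizers. *)

theory Defs
  imports Complex_Main "HOL-Library.FuncSet" "HOL-Library.Extended_Real"
begin

text \<open>
  Finite simple graphs are given by a vertex set \<open>V\<close> and a set \<open>E\<close> of two-element edges.
\<close>

definition fin_graph :: "'a set \<Rightarrow> 'a set set \<Rightarrow> bool" where
  "fin_graph V E \<longleftrightarrow> finite V \<and> (\<forall>e\<in>E. e \<subseteq> V \<and> card e = 2)"

definition is_clique :: "'a set \<Rightarrow> 'a set set \<Rightarrow> 'a set \<Rightarrow> bool" where
  "is_clique V E K \<longleftrightarrow> K \<subseteq> V \<and> (\<forall>u\<in>K. \<forall>v\<in>K. u \<noteq> v \<longrightarrow> {u, v} \<in> E)"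

definition max_cliques :: "'a set \<Rightarrow> 'a set set \<Rightarrow> 'a set set" where
  "max_cliques V E = {K. is_clique V E K \<and> (\<forall>K'. is_clique V E K' \<and> K \<subseteq> K' \<longrightarrow> K' = K)}"

definition proper_coloring :: "'a set \<Rightarrow> 'a set set \<Rightarrow> nat \<Rightarrow> ('a \<Rightarrow> nat) \<Rightarrow> bool" where
  "proper_coloring V E k col \<longleftrightarrow>
     (\<forall>v\<in>V. col v < k) \<and> (\<forall>u v. {u, v} \<in> E \<longrightarrow> col u \<noteq> col v)"

definition chromatic_number :: "'a set \<Rightarrow> 'a set set \<Rightarrow> nat" where
  "chromatic_number V E = (LEAST k. \<exists>col. proper_coloring V E k col)"

definition clique_number :: "'a set \<Rightarrow> 'a set set \<Rightarrow> nat" where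
  "clique_number V E = Max (card ` {K. is_clique V E K})"

definition induced_edges :: "'a set set \<Rightarrow> 'a set \<Rightarrow> 'a set set" where
  "induced_edges E W = {e \<in> E. e \<subseteq> W}"

definition perfect_graph :: "'a set \<Rightarrow> 'a set set \<Rightarrow> bool" where
  "perfect_graph V E \<longleftrightarrow>
     (\<forall>W\<subseteq>V. chromatic_number W (induced_edges E W) = clique_number W (induced_edges E W))"


text \<open>
  Graphical models: \<open>s i\<close> is the number of settings of the variable at vertex \<open>i\<close>, and the
  joint configurations of the variables in \<open>c\<close> are the extensional functions on \<open>c\<close>, so
  that each configuration is represented exactly once.
\<close>

definition configs :: "('v \<Rightarrow> nat) \<Rightarrow> 'v set \<Rightarrow> ('v \<Rightarrow> nat) set" where
  "configs s c = (\<Pi>\<^sub>E i\<in>c. {..<s i})"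

definition graphical_model ::
  "'v set \<Rightarrow> 'v set set \<Rightarrow> ('v \<Rightarrow> nat) \<Rightarrow> ('v set \<Rightarrow> ('v \<Rightarrow> nat) \<Rightarrow> real) \<Rightarrow> bool" where
  "graphical_model V E s \<psi> \<longleftrightarrow>
     fin_graph V E \<and> (\<forall>i\<in>V. s i \<ge> 2) \<and>
     (\<forall>c\<in>max_cliques V E. \<forall>x\<in>configs s c. \<psi> c x > 1)"


text \<open>
  Nand Markov random fields: the vertex of the binary variable for clique \<open>c\<close> and
  configuration \<open>x\<close> is the pair \<open>(c, x)\<close>.
\<close>

type_synonym 'v nvertex = "'v set \<times> ('v \<Rightarrow> nat)"

definition nmrf_verts :: "'v set \<Rightarrow> 'v set set \<Rightarrow> ('v \<Rightarrow> nat) \<Rightarrow> 'v nvertex set" where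
  "nmrf_verts V E s = (SIGMA c:max_cliques V E. configs s c)"

definition nmrf_edges :: "'v set \<Rightarrow> 'v set set \<Rightarrow> ('v \<Rightarrow> nat) \<Rightarrow> 'v nvertex set set" where
  "nmrf_edges V E s =
     {{(c, x), (d, y)} | c x d y.
        (c, x) \<in> nmrf_verts V E s \<and> (d, y) \<in> nmrf_verts V E s \<and> (\<exists>i\<in>c \<inter> d. x i \<noteq> y i)}"

definition nmrf_weight :: "('v set \<Rightarrow> ('v \<Rightarrow> nat) \<Rightarrow> real) \<Rightarrow> 'v nvertex \<Rightarrow> real" where
  "nmrf_weight \<psi> = (\<lambda>(c, x). ln (\<psi> c x))"


text \<open>
  Nand objective and convergent message passing on a graph \<open>(N, A)\<close> with weights \<open>f\<close>; the
  binary variables take values in \<open>{0, 1} :: nat set\<close>. An edge \<open>e = {i, j}\<close> contributes the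
  factor \<open>\<delta>(x\<^sub>i + x\<^sub>j \<le> 1)\<close>.
\<close>

definition nand_objective :: "'n set \<Rightarrow> 'n set set \<Rightarrow> ('n \<Rightarrow> real) \<Rightarrow> ('n \<Rightarrow> nat) \<Rightarrow> real" where
  "nand_objective N A f x =
     (\<Prod>i\<in>N. exp (f i * real (x i))) * (\<Prod>e\<in>A. of_bool ((\<Sum>i\<in>e. x i) \<le> 1))"

definition is_MAP :: "'n set \<Rightarrow> 'n set set \<Rightarrow> ('n \<Rightarrow> real) \<Rightarrow> ('n \<Rightarrow> nat) \<Rightarrow> bool" where
  "is_MAP N A f = is_arg_max (nand_objective N A f) (\<lambda>x. x \<in> N \<rightarrow> {0, 1})"

definition nbrs :: "'n set set \<Rightarrow> 'n \<Rightarrow> 'n set" where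
  "nbrs A i = {j. {i, j} \<in> A}"

text \<open>
  The logarithm of \<open>\<delta>\<close> is taken in the extended reals, since \<open>ln 0 = 0\<close> on the reals.
\<close>

definition log_delta :: "bool \<Rightarrow> ereal" where
  "log_delta P = (if P then 0 else -\<infinity>)"

definition edge_potential ::
  "'n set set \<Rightarrow> ('n \<Rightarrow> real) \<Rightarrow> 'n \<Rightarrow> 'n \<Rightarrow> nat \<Rightarrow> nat \<Rightarrow> ereal" where
  "edge_potential A f i j xi xj =
     ereal (real xi * f i / real (card (nbrs A i)) + real xj * f j / real (card (nbrs A j)))
     + log_delta (xi + xj \<le> 1)"

text \<open>
  \<open>lam j i xi\<close> is the message from \<open>j\<close> to \<open>i\<close> at the value \<open>xi\<close> of the variable at \<open>i\<close>.
  \<open>msg_update A f lam j i xi\<close> is the value assigned to it by the update of the edge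
  \<open>{i, j}\<close>. As edge potentials are symmetric, exchanging \<open>i\<close> and \<open>j\<close> gives the
  simultaneous update of the opposite message.
\<close>

type_synonym 'n messages = "'n \<Rightarrow> 'n \<Rightarrow> nat \<Rightarrow> real"

definition msg_update ::
  "'n set set \<Rightarrow> ('n \<Rightarrow> real) \<Rightarrow> 'n messages \<Rightarrow> 'n \<Rightarrow> 'n \<Rightarrow> nat \<Rightarrow> ereal" where
  "msg_update A f lam j i xi =
     ereal (- (1/2) * (\<Sum>k\<in>nbrs A i - {j}. lam k i xi))
     + ereal (1/2) *
       (MAX xj\<in>{0, 1}. ereal (\<Sum>k\<in>nbrs A j - {i}. lam k j xj) + edge_potential A f i j xi xj)"

definition cmp_fixed_point :: "'n set set \<Rightarrow> ('n \<Rightarrow> real) \<Rightarrow> 'n messages \<Rightarrow> bool" where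
  "cmp_fixed_point A f lam \<longleftrightarrow>
     (\<forall>i j. {i, j} \<in> A \<longrightarrow> (\<forall>xi\<in>{0, 1}. ereal (lam j i xi) = msg_update A f lam j i xi))"

definition belief :: "'n set set \<Rightarrow> 'n messages \<Rightarrow> 'n \<Rightarrow> nat \<Rightarrow> real" where
  "belief A lam i xi = (\<Sum>j\<in>nbrs A i. lam j i xi)"

text \<open>
  An output picks a maximizing value of the belief at each vertex. Where the two beliefs
  at a vertex tie, either value may be picked; \<open>tie_free\<close> says that this never happens, i.e.
  that the output is uniquely determined on \<open>N\<close>.
\<close>

definition cmp_output :: "'n set \<Rightarrow> 'n set set \<Rightarrow> 'n messages \<Rightarrow> ('n \<Rightarrow> nat) \<Rightarrow> bool" where
  "cmp_output N A lam xh \<longleftrightarrow>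
     (\<forall>i\<in>N. is_arg_max (belief A lam i) (\<lambda>v. v \<in> {0, 1}) (xh i))"

definition tie_free :: "'n set \<Rightarrow> 'n set set \<Rightarrow> 'n messages \<Rightarrow> bool" where
  "tie_free N A lam \<longleftrightarrow> (\<forall>i\<in>N. \<exists>!v. is_arg_max (belief A lam i) (\<lambda>v. v \<in> {0, 1}) v)"

end

(*
  Write b for the beliefs. A fixed point is a reparametrization: with
  t_ij(x, y) = theta_ij(x, y) - lam_ji(x) - lam_ij(y), the fixed-point equations read
  b_i(x) = max_y (b_j(y) + t_ij(x, y)) for every edge ij, which forces t_ij <= 0.
  As log rho is the sum of all b_i and all t_ij (up to isolated vertices), one can argue as
  for the persistency theorem of Nemhauser and Trotter: moving a MAP assignment to the
  maximizer of b_i at every vertex without a tie keeps it feasible, does not decrease any b_i,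
  and makes t_ij zero on every edge that it affects. So the new assignment is a MAP estimate
  as well, and it is an output. Without ties the output is unique.
*)
theory Submission
  imports Defs
begin

section \<open>Finite simple graphs\<close>

lemma fin_graph_edgeD:
  assumes "fin_graph N A" "{i, j} \<in> A"
  shows "i \<in> N" "j \<in> N" "i \<noteq> j"
  using assms by (auto simp: fin_graph_def dest!: bspec)

lemma fin_graph_edgeE:
  assumes "fin_graph N A" "e \<in> A"
  obtains i j where "e = {i, j}" "i \<noteq> j"
  using assms by (auto simp: fin_graph_def card_2_iff)

lemma finite_nbrs: "fin_graph N A \<Longrightarrow> finite (nbrs A i)"
  using fin_graph_edgeD(2)[of N A i] finite_subset[of "nbrs A i" N]
  unfolding nbrs_def fin_graph_def by blast

lemma finite_edges: "fin_graph N A \<Longrightarrow> finite A"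
  by (rule finite_subset[of _ "Pow N"]) (auto simp: fin_graph_def)

lemma sum_pair: "i \<noteq> j \<Longrightarrow> (\<Sum>k\<in>{i, j}. x k) = x i + x j"
  for x :: "'a \<Rightarrow> nat"
  by simp

section \<open>The nand objective and its maximizers\<close>

lemma nand_objective_feasible:
  assumes "finite N" "\<And>e. e \<in> A \<Longrightarrow> (\<Sum>i\<in>e. x i) \<le> 1"
  shows "nand_objective N A f x = exp (\<Sum>i\<in>N. f i * real (x i))"
  using assms by (simp add: nand_objective_def exp_sum)

lemma nand_objective_infeasible:
  assumes "finite A" "e \<in> A" "\<not> (\<Sum>i\<in>e. x i) \<le> 1"
  shows "nand_objective N A f x = 0"
proof -
  have "(\<Prod>e\<in>A. of_bool ((\<Sum>i\<in>e. x i) \<le> 1)) = (0::real)"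
    using assms by (intro prod_zero bexI[of _ e]) auto
  then show ?thesis
    by (simp add: nand_objective_def)
qed

lemma nand_objective_cong:
  assumes "fin_graph N A" "\<And>i. i \<in> N \<Longrightarrow> x i = y i"
  shows "nand_objective N A f x = nand_objective N A f y"
proof -
  have "(\<Sum>i\<in>e. x i) = (\<Sum>i\<in>e. y i)" if "e \<in> A" for e
    using assms that by (intro sum.cong) (auto simp: fin_graph_def)
  then show ?thesis
    using assms(2) by (simp add: nand_objective_def)
qed

lemma is_MAP_cong:
  assumes "fin_graph N A" "\<And>i. i \<in> N \<Longrightarrow> x i = y i" "is_MAP N A f x"
  shows "is_MAP N A f y"
  using assms(3) nand_objective_cong[of N A x y f, OF assms(1,2)]
  by (auto simp: is_MAP_def is_arg_max_def Pi_iff assms(2)[symmetric])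

lemma MAP_exists:
  assumes "fin_graph N A"
  obtains x where "is_MAP N A f x"
proof -
  \<comment> \<open>\<open>N \<rightarrow> {0, 1}\<close> leaves the values outside \<open>N\<close>
    free and may be infinite. Extensional functions form a finite set of representatives with the
    same objective values.\<close>
  let ?F = "nand_objective N A f" and ?X = "N \<rightarrow>\<^sub>E {0, 1::nat}"
  have fin: "finite ?X"
    using assms by (auto simp: fin_graph_def intro!: finite_PiE)
  have "?X \<noteq> {}"
    by (auto simp: PiE_eq_empty_iff)
  then have "Max (?F ` ?X) \<in> ?F ` ?X"
    by (intro Max_in finite_imageI fin) (simp only: image_is_empty not_False_eq_True)
  then obtain x where x: "Max (?F ` ?X) = ?F x" "x \<in> ?X"
    by (rule imageE)
  have "?F y \<le> ?F x" if "y \<in> N \<rightarrow> {0, 1}" for y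
  proof -
    have "restrict y N \<in> ?X"
      using that by auto
    then have "?F (restrict y N) \<le> ?F x"
      unfolding x(1)[symmetric] by (intro Max_ge finite_imageI fin imageI)
    moreover have "?F (restrict y N) = ?F y"
      by (rule nand_objective_cong[OF assms]) simp
    ultimately show ?thesis by simp
  qed
  then have "is_MAP N A f x"
    using x(2) by (auto simp: is_MAP_def is_arg_max_linorder PiE_def)
  then show ?thesis by (rule that)
qed

text \<open>An infeasible assignment has objective 0 and so loses to the zero assignment, whose
  objective is 1.\<close>

lemma MAP_feasible:
  assumes "fin_graph N A" "is_MAP N A f x" "{i, j} \<in> A"
  shows "x i + x j \<le> 1"
proof (rule ccontr)
  assume "\<not> x i + x j \<le> 1"
  then have "nand_objective N A f x = 0"
    using finite_edges[OF assms(1)] assms(3) fin_graph_edgeD(3)[OF assms(1,3)]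
    by (intro nand_objective_infeasible[of A "{i, j}"]) auto
  moreover have "nand_objective N A f (\<lambda>_. 0) = 1"
    using assms(1) by (subst nand_objective_feasible) (auto simp: fin_graph_def)
  ultimately show False
    using assms(2) by (auto simp: is_MAP_def is_arg_max_def)
qed

section \<open>Fixed-point equations\<close>

text \<open>
  \<open>fixed_point_1\<close> has no maximum because \<open>\<delta>\<close> excludes the value 1 at \<open>j\<close>.
\<close>

lemma
  fixes f :: "'n \<Rightarrow> real"
  assumes "fin_graph N A" "cmp_fixed_point A f lam" "{i, j} \<in> A"
  shows fixed_point_0: "belief A lam i 0 + lam j i 0 =
      max (belief A lam j 0 - lam i j 0)
          (belief A lam j 1 - lam i j 1 + f j / real (card (nbrs A j)))" (is ?zero)
    and fixed_point_1: "belief A lam i 1 + lam j i 1 =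
      belief A lam j 0 - lam i j 0 + f i / real (card (nbrs A i))" (is ?one)
proof -
  have mem: "j \<in> nbrs A i" "i \<in> nbrs A j"
    using assms(3) by (auto simp: nbrs_def insert_commute)
  have others: "(\<Sum>k\<in>nbrs A i - {j}. lam k i x) = belief A lam i x - lam j i x"
    "(\<Sum>k\<in>nbrs A j - {i}. lam k j x) = belief A lam j x - lam i j x" for x
    using mem finite_nbrs[OF assms(1)] by (simp_all add: belief_def sum_diff1)
  have upd: "msg_update A f lam j i x = ereal (- (1/2) * (belief A lam i x - lam j i x)) +
      ereal (1/2) *
        max (ereal (belief A lam j 0 - lam i j 0) + edge_potential A f i j x 0)
            (ereal (belief A lam j 1 - lam i j 1) + edge_potential A f i j x 1)" for x
    unfolding msg_update_def others by simp
  \<comment> \<open>At a fixed point the message \<open>l\<close> is also one summand of the belief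
    \<open>b\<close>; solving for it removes the damping factor 1/2.\<close>
  have solve: "b + l = m" if "l = - (1/2) * (b - l) + m / 2" for b l m :: real
    using that by (simp add: field_simps)
  have "ereal (lam j i 0) = msg_update A f lam j i 0"
    using assms(2,3) unfolding cmp_fixed_point_def by blast
  also have "\<dots> = ereal (- (1/2) * (belief A lam i 0 - lam j i 0) +
      max (belief A lam j 0 - lam i j 0)
          (belief A lam j 1 - lam i j 1 + f j / real (card (nbrs A j))) / 2)"
    unfolding upd by (simp add: edge_potential_def log_delta_def max_def)
  finally show ?zero
    unfolding ereal.inject by (rule solve)
  have "ereal (lam j i 1) = msg_update A f lam j i 1"
    using assms(2,3) unfolding cmp_fixed_point_def by blast
  also have "\<dots> = ereal (- (1/2) * (belief A lam i 1 - lam j i 1) +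
      (belief A lam j 0 - lam i j 0 + f i / real (card (nbrs A i))) / 2)"
    unfolding upd by (simp add: edge_potential_def log_delta_def)
  finally show ?one
    unfolding ereal.inject by (rule solve)
qed

section \<open>Moving an assignment to the maximizers of the beliefs\<close>

text \<open>Ties keep the value of \<open>x\<close>, since picking 1 at two adjacent tied vertices
  would break feasibility.\<close>

definition maximize_beliefs :: "'n set set \<Rightarrow> 'n messages \<Rightarrow> ('n \<Rightarrow> nat) \<Rightarrow> 'n \<Rightarrow> nat" where
  "maximize_beliefs A lam x i =
     (if belief A lam i 0 < belief A lam i 1 then 1
      else if belief A lam i 1 < belief A lam i 0 then 0 else x i)"

lemma maximize_beliefs_range:
  "x \<in> N \<rightarrow> {0, 1} \<Longrightarrow> maximize_beliefs A lam x \<in> N \<rightarrow> {0, 1}"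
  by (auto simp: maximize_beliefs_def Pi_iff)

lemma belief_le_maximize:
  assumes "x i \<in> {0, 1}" "v \<in> {0, 1}"
  shows "belief A lam i v \<le> belief A lam i (maximize_beliefs A lam x i)"
  using assms by (auto simp: maximize_beliefs_def)

lemma cmp_output_maximize_beliefs:
  assumes "x \<in> N \<rightarrow> {0, 1}"
  shows "cmp_output N A lam (maximize_beliefs A lam x)"
  unfolding cmp_output_def is_arg_max_linorder
proof (intro ballI conjI)
  fix i assume "i \<in> N"
  then show "maximize_beliefs A lam x i \<in> {0, 1}"
    using maximize_beliefs_range[OF assms] by (rule funcset_mem[rotated])
  show "\<forall>v. v \<in> {0, 1} \<longrightarrow> belief A lam i v \<le> belief A lam i (maximize_beliefs A lam x i)"
    using belief_le_maximize[of x i] funcset_mem[OF assms \<open>i \<in> N\<close>] by blast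
qed

text \<open>\<open>h i j v\<close> is the share of \<open>i\<close> in t_ij: for feasible values,
  t_ij(u, v) = \<open>h i j u + h j i v\<close>. If both ends are tied, nothing changes on the edge.
  Otherwise t_ij is 0 at the new values and at most 0 at the old ones.\<close>

lemma
  fixes f :: "'n \<Rightarrow> real" and x :: "'n \<Rightarrow> nat"
  assumes "fin_graph N A" "cmp_fixed_point A f lam" "{i, j} \<in> A"
    and "x i \<in> {0, 1}" "x j \<in> {0, 1}" "x i + x j \<le> 1"
  defines "x' \<equiv> maximize_beliefs A lam x"
    and "h \<equiv> \<lambda>i j v. real v * f i / real (card (nbrs A i)) - lam j i v"
  shows maximize_beliefs_feasible: "x' i + x' j \<le> 1"
    and maximize_beliefs_edge: "h i j (x i) + h j i (x j) \<le> h i j (x' i) + h j i (x' j)"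
proof -
  have "{j, i} \<in> A"
    using assms(3) by (simp add: insert_commute)
  note eqs = fixed_point_0[OF assms(1,2,3)] fixed_point_1[OF assms(1,2,3)]
    fixed_point_0[OF assms(1,2) this] fixed_point_1[OF assms(1,2) this]
  note eqs = eqs[unfolded One_nat_def]
  have x: "x i = 0 \<and> x j = 0 \<or> x i = 0 \<and> x j = 1 \<or> x i = 1 \<and> x j = 0"
    using assms(4-6) by auto
  show "x' i + x' j \<le> 1"
    \<comment> \<open>As t_ij \<le> 0, the equations give b_i(1) \<le> b_j(0) and b_j(1) \<le>
      b_i(0). So b_i(0) < b_i(1) forces b_j(1) < b_j(0), and a vertex that strictly prefers 1 has
      only neighbours that strictly prefer 0.\<close>
    unfolding x'_def maximize_beliefs_def using x
    by (auto, (use eqs in linarith)+)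
  show "h i j (x i) + h j i (x j) \<le> h i j (x' i) + h j i (x' j)"
    \<comment> \<open>The equations give \<open>i\<close> and \<open>j\<close> the same largest
      belief. If \<open>i\<close> has no tie, the maximum that defines b_j at \<open>x' j\<close>
      can reach it only through \<open>x' i\<close>, and only if t_ij is 0 there. The same holds
      with \<open>i\<close> and \<open>j\<close> exchanged.\<close>
    unfolding x'_def h_def maximize_beliefs_def using x
    by (auto, (use eqs in linarith)+)
qed

text \<open>Every edge occurs in the double sum once in each direction, so adding the sum to its
  copy with \<open>i\<close> and \<open>j\<close> swapped pairs \<open>d i j\<close> with
  \<open>d j i\<close>.\<close>

lemma sum_edges_nonneg:
  fixes d :: "'n \<Rightarrow> 'n \<Rightarrow> real"
  assumes "fin_graph N A" "\<And>i j. {i, j} \<in> A \<Longrightarrow> 0 \<le> d i j + d j i"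
  shows "0 \<le> (\<Sum>i\<in>N. \<Sum>j\<in>nbrs A i. d i j)"
proof -
  let ?R = "SIGMA i:N. nbrs A i"
  have eq: "(\<Sum>i\<in>N. \<Sum>j\<in>nbrs A i. d i j) = (\<Sum>(i, j)\<in>?R. d i j)"
    using assms(1) finite_nbrs[OF assms(1)] by (subst sum.Sigma) (auto simp: fin_graph_def)
  have "(\<Sum>(i, j)\<in>?R. d i j) = (\<Sum>(i, j)\<in>?R. d j i)"
    using fin_graph_edgeD[OF assms(1)]
    by (intro sum.reindex_bij_witness[of _ prod.swap prod.swap])
       (auto simp: nbrs_def insert_commute)
  then have "2 * (\<Sum>(i, j)\<in>?R. d i j) = (\<Sum>(i, j)\<in>?R. d i j + d j i)"
    by (simp add: sum.distrib case_prod_unfold)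
  also have "\<dots> \<ge> 0"
    using assms(2) by (auto simp: nbrs_def intro!: sum_nonneg)
  finally show ?thesis
    using eq by simp
qed

text \<open>Summed over the neighbours of \<open>i\<close>, \<open>h i j v\<close> gives
  \<open>f i * v\<close> minus the belief at \<open>v\<close>. The gain in weight is thus the gain
  in the beliefs plus the gain in the edge terms, and neither total is negative.\<close>

lemma maximize_beliefs_weight:
  fixes f :: "'n \<Rightarrow> real" and x :: "'n \<Rightarrow> nat"
  assumes "fin_graph N A" "cmp_fixed_point A f lam" "x \<in> N \<rightarrow> {0, 1}"
    and feas: "\<And>i j. {i, j} \<in> A \<Longrightarrow> x i + x j \<le> 1"
  defines "x' \<equiv> maximize_beliefs A lam x"
  shows "(\<Sum>i\<in>N. f i * real (x i)) \<le> (\<Sum>i\<in>N. f i * real (x' i))"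
proof -
  define h where "h = (\<lambda>i j v. real v * f i / real (card (nbrs A i)) - lam j i v)"
  define d where "d = (\<lambda>i j. h i j (x' i) - h i j (x i))"
  have "0 \<le> d i j + d j i" if "{i, j} \<in> A" for i j
    using maximize_beliefs_edge[OF assms(1,2) that funcset_mem[OF assms(3)]
        funcset_mem[OF assms(3)] feas[OF that]] fin_graph_edgeD[OF assms(1) that]
    unfolding d_def h_def x'_def by linarith
  then have d: "0 \<le> (\<Sum>i\<in>N. \<Sum>j\<in>nbrs A i. d i j)"
    by (rule sum_edges_nonneg[OF assms(1)])
  have "f i * real (x' i) - f i * real (x i) =
      (belief A lam i (x' i) - belief A lam i (x i)) + (\<Sum>j\<in>nbrs A i. d i j)" for i
  proof (cases "nbrs A i = {}")
    \<comment> \<open>An isolated vertex has no neighbours to share its weight, but both its beliefs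
      are empty sums, so it is tied and keeps its value.\<close>
    case True
    then show ?thesis
      by (simp add: x'_def maximize_beliefs_def belief_def)
  next
    case False
    then have "card (nbrs A i) \<noteq> 0"
      using finite_nbrs[OF assms(1)] by simp
    then show ?thesis
      by (simp add: d_def h_def belief_def sum_subtractf mult.commute)
  qed
  moreover have "0 \<le> belief A lam i (x' i) - belief A lam i (x i)" if "i \<in> N" for i
    using belief_le_maximize[of x i "x i"] funcset_mem[OF assms(3) that]
    unfolding x'_def by simp
  ultimately have "(\<Sum>j\<in>nbrs A i. d i j) \<le> f i * real (x' i) - f i * real (x i)"
    if "i \<in> N" for i
    using that by fastforce
  then have "(\<Sum>i\<in>N. \<Sum>j\<in>nbrs A i. d i j) \<le> (\<Sum>i\<in>N. f i * real (x' i) - f i * real (x i))"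
    by (rule sum_mono)
  then show ?thesis
    using d by (simp add: sum_subtractf)
qed

lemma is_MAP_maximize_beliefs:
  assumes "fin_graph N A" "cmp_fixed_point A f lam" "is_MAP N A f x"
  shows "is_MAP N A f (maximize_beliefs A lam x)"
proof -
  let ?x' = "maximize_beliefs A lam x"
  have x: "x \<in> N \<rightarrow> {0, 1}"
    using assms(3) by (simp add: is_MAP_def is_arg_max_def)
  have feas: "x i + x j \<le> 1" if "{i, j} \<in> A" for i j
    using MAP_feasible[OF assms(1,3) that] .
  have feas': "?x' i + ?x' j \<le> 1" if "{i, j} \<in> A" for i j
    using maximize_beliefs_feasible[OF assms(1,2) that funcset_mem[OF x] funcset_mem[OF x]
        feas[OF that]] fin_graph_edgeD[OF assms(1) that] by blast
  have obj: "nand_objective N A f y = exp (\<Sum>i\<in>N. f i * real (y i))"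
    if "\<And>i j. {i, j} \<in> A \<Longrightarrow> y i + y j \<le> 1" for y
  proof (rule nand_objective_feasible)
    show "finite N"
      using assms(1) by (simp add: fin_graph_def)
    show "(\<Sum>i\<in>e. y i) \<le> 1" if "e \<in> A" for e
      using \<open>e \<in> A\<close> \<open>\<And>i j. {i, j} \<in> A \<Longrightarrow> y i + y j \<le> 1\<close>
      by (metis fin_graph_edgeE[OF assms(1)] sum_pair)
  qed
  have "nand_objective N A f x \<le> nand_objective N A f ?x'"
    using maximize_beliefs_weight[OF assms(1,2) x feas] obj[of x, OF feas] obj[of ?x', OF feas']
    by simp
  then show ?thesis
    using assms(3) maximize_beliefs_range[OF x] unfolding is_MAP_def is_arg_max_linorder
    by (meson order_trans)
qed

lemma cmp_output_unique:
  assumes "tie_free N A lam" "cmp_output N A lam x" "cmp_output N A lam y" "i \<in> N"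
  shows "x i = y i"
  using assms unfolding tie_free_def cmp_output_def by blast

section \<open>The nand Markov random field\<close>

lemma fin_graph_nmrf:
  assumes "fin_graph V E"
  shows "fin_graph (nmrf_verts V E s) (nmrf_edges V E s)"
proof -
  have V: "finite V"
    using assms by (simp add: fin_graph_def)
  have sub: "max_cliques V E \<subseteq> Pow V"
    by (auto simp: max_cliques_def is_clique_def)
  then have "finite (max_cliques V E)"
    using V by (simp add: finite_subset)
  moreover have "finite (configs s c)" if "c \<in> max_cliques V E" for c
    using sub that V by (auto simp: configs_def intro!: finite_PiE intro: finite_subset)
  ultimately have "finite (nmrf_verts V E s)"
    unfolding nmrf_verts_def by blast
  \<comment> \<open>The ends of an edge disagree at a vertex common to both cliques, so they are
    distinct and the edge is no singleton.\<close>
  moreover have "e \<subseteq> nmrf_verts V E s \<and> card e = 2" if "e \<in> nmrf_edges V E s" for e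
    using that by (auto simp: nmrf_edges_def card_2_iff)
  ultimately show ?thesis
    by (simp add: fin_graph_def)
qed

theorem corollary3:
  fixes V :: "'v set" and E :: "'v set set" and s :: "'v \<Rightarrow> nat"
    and \<psi> :: "'v set \<Rightarrow> ('v \<Rightarrow> nat) \<Rightarrow> real"
    and lam :: "'v nvertex messages"
  assumes "graphical_model V E s \<psi>"
    and "perfect_graph (nmrf_verts V E s) (nmrf_edges V E s)"
    and "cmp_fixed_point (nmrf_edges V E s) (nmrf_weight \<psi>) lam"
  shows "(tie_free (nmrf_verts V E s) (nmrf_edges V E s) lam \<longrightarrow>
            (\<forall>xh. cmp_output (nmrf_verts V E s) (nmrf_edges V E s) lam xh \<longrightarrow>
                  is_MAP (nmrf_verts V E s) (nmrf_edges V E s) (nmrf_weight \<psi>) xh)) \<and>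
         (\<exists>xh. cmp_output (nmrf_verts V E s) (nmrf_edges V E s) lam xh \<and>
               is_MAP (nmrf_verts V E s) (nmrf_edges V E s) (nmrf_weight \<psi>) xh)"
proof -
  let ?N = "nmrf_verts V E s" and ?A = "nmrf_edges V E s" and ?f = "nmrf_weight \<psi>"
  have G: "fin_graph ?N ?A"
    using assms(1) by (simp add: graphical_model_def fin_graph_nmrf)
  obtain x where x: "is_MAP ?N ?A ?f x"
    using MAP_exists[OF G] .
  define xh where "xh = maximize_beliefs ?A lam x"
  have out: "cmp_output ?N ?A lam xh"
    using x unfolding xh_def is_MAP_def is_arg_max_def by (intro cmp_output_maximize_beliefs) simp
  have MAP: "is_MAP ?N ?A ?f xh"
    unfolding xh_def by (rule is_MAP_maximize_beliefs[OF G assms(3) x])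
  \<comment> \<open>Without ties \<open>y\<close> agrees with \<open>xh\<close> on all vertices, and
    being a MAP estimate depends only on the values there.\<close>
  have "is_MAP ?N ?A ?f y" if "tie_free ?N ?A lam" "cmp_output ?N ?A lam y" for y
    using is_MAP_cong[OF G _ MAP] cmp_output_unique[OF that(1) out that(2)] by blast
  then show ?thesis
    using out MAP by blast
qed

end
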